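(* Let $d\ge 1$ and let $\Sigma'\subset\mathbb{C}^{2d}$ be the set of those $\mu\in\mathbb{C}^{2d}$ for which the Prony problem of order $d$ is unsolvable. As the right-hand side $\mu\in\mathbb{C}^{2d}\setminus\Sigma'$ approaches a finite point $\mu_0\in\Sigma'$, at least one of the nodes in the solution of the Prony problem with right-hand side $\mu$ tends to infinity; that is, the maximum of the absolute values of the nodes $x_j$ of the solution tends to infinity as $\mu\to\mu_0$, $\mu\in\mathbb{C}^{2d}\setminus\Sigma'$.
   Context: **Prony problem of order $d$.** Given $\mu=(m_0,\dots,m_{2d-1})\in\mathbb{C}^{2d}$, find a multiplicity vector $D=(d_1,\dots,d_s)$ of positive integers with $\sum_{j=1}^s d_j\le d$, pairwise distinct nodes $x_1,\dots,x_s\in\mathbb{C}$ and coefficients $a_{j,\ell}\in\mathbb{C}$ ($1\le j\le s$, $0\le \ell\le d_j-1$), with $a_{j,d_j-1}\ne 0$ for all $j$, such that $$\sum_{j=1}^{s}\sum_{\ell=0}^{d_j-1} a_{j,\ell}\,\frac{k!}{(k-\ell)!}\,x_j^{k-\ell}=m_k,\qquad k=0,1,\dots,2d-1,$$ where $\frac{k!}{(k-\ell)!}x_j^{k-\ell}$ denotes the $\ell$-th derivative of $x^k$ at $x_j$ (so it is $0$ if $\ell>k$). The zero signal ($s=0$) is allowed. When a solution exists it is unique up to a permutation of the nodes. *)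

theory Defs
  imports "HOL-Analysis.Analysis"
begin

text \<open>
  The space \<open>\<complex>\<^sup>n\<close> is carried by the extensional functions on \<open>{0,\<dots>,n-1}\<close>. Filters on it come from
  the product topology on \<^typ>\<open>nat \<Rightarrow> complex\<close>; by lemma \<open>eventually_at_cvec\<close> this is the Euclidean
  topology of \<open>\<complex>\<^sup>n\<close>.
\<close>

definition cvec :: "nat \<Rightarrow> (nat \<Rightarrow> complex) set" where
  "cvec n = {..<n} \<rightarrow>\<^sub>E UNIV"

lemma eventually_at_cvec:
  assumes S: "S \<subseteq> cvec n" and \<mu>0: "\<mu>0 \<in> cvec n"
  shows "eventually P (at \<mu>0 within S) \<longleftrightarrow>
    (\<exists>e>0. \<forall>\<mu>\<in>S. \<mu> \<noteq> \<mu>0 \<and> L2_set (\<lambda>k. cmod (\<mu> k - \<mu>0 k)) {..<n} < e \<longrightarrow> P \<mu>)"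
    (is "_ \<longleftrightarrow> ?R")
proof
  assume "eventually P (at \<mu>0 within S)"
  then obtain U where U: "open U" "\<mu>0 \<in> U" "\<forall>\<mu>\<in>U. \<mu> \<noteq> \<mu>0 \<longrightarrow> \<mu> \<in> S \<longrightarrow> P \<mu>"
    unfolding eventually_at_topological by auto
  from U(1) have "openin (product_topology (\<lambda>i. euclidean) UNIV) U"
    by (simp add: open_fun_def)
  from product_topology_open_contains_basis[OF this U(2)]
  obtain X where X: "\<mu>0 \<in> Pi\<^sub>E UNIV X" "\<And>i. open (X i)" "Pi\<^sub>E UNIV X \<subseteq> U"
    by auto
  have "\<forall>k. \<exists>e>0. ball (\<mu>0 k) e \<subseteq> X k"
    using X(1,2) by (meson PiE_mem UNIV_I open_contains_ball)
  then obtain e where e: "\<And>k. e k > 0" "\<And>k. ball (\<mu>0 k) (e k) \<subseteq> X k"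
    by metis
  define r where "r = Min (insert 1 (e ` {..<n}))"
  have r: "r > 0" "\<And>k. k < n \<Longrightarrow> r \<le> e k"
    using e(1) by (auto simp: r_def)
  have "P \<mu>" if "\<mu> \<in> S" "\<mu> \<noteq> \<mu>0" "L2_set (\<lambda>k. cmod (\<mu> k - \<mu>0 k)) {..<n} < r" for \<mu>
  proof -
    have "\<mu> k \<in> X k" for k
    proof (cases "k < n")
      case True
      then have "cmod (\<mu> k - \<mu>0 k) \<le> L2_set (\<lambda>k. cmod (\<mu> k - \<mu>0 k)) {..<n}"
        by (intro member_le_L2_set) auto
      also have "\<dots> < e k" using that(3) r(2)[OF True] by simp
      finally show ?thesis
        using e(2)[of k] by (auto simp: dist_norm norm_minus_commute subset_iff)
    next
      case False
      then have "\<mu> k = \<mu>0 k"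
        using that(1) S \<mu>0 by (auto simp: cvec_def PiE_def extensional_def)
      then show ?thesis using X(1) by auto
    qed
    then show ?thesis using X(3) U(3) that by auto
  qed
  then show ?R using r(1) by blast
next
  assume ?R
  then obtain e where e: "e > 0"
    "\<forall>\<mu>\<in>S. \<mu> \<noteq> \<mu>0 \<and> L2_set (\<lambda>k. cmod (\<mu> k - \<mu>0 k)) {..<n} < e \<longrightarrow> P \<mu>"
    by blast
  let ?U = "{\<mu>. L2_set (\<lambda>k. cmod (\<mu> k - \<mu>0 k)) {..<n} < e}"
  have "open ?U"
    unfolding L2_set_def
    by (intro open_Collect_less continuous_intros continuous_on_product_then_coordinatewise)
  moreover have "\<mu>0 \<in> ?U" using e(1) by (simp add: L2_set_def)
  ultimately show "eventually P (at \<mu>0 within S)"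
    unfolding eventually_at_topological using e(2) by (intro exI[of _ ?U]) auto
qed

text \<open>
  Indices are shifted: \<open>j\<close> ranges over \<open>{0,\<dots>,s-1}\<close>. Values of the fields at indices outside the ranges
  used in \<open>prony_solution\<close> are irrelevant.
\<close>

record prony_signal =
  num_nodes :: nat
  mult :: "nat \<Rightarrow> nat"
  node :: "nat \<Rightarrow> complex"
  coef :: "nat \<Rightarrow> nat \<Rightarrow> complex"

definition power_deriv :: "nat \<Rightarrow> nat \<Rightarrow> complex \<Rightarrow> complex" where
  "power_deriv l k x = (if l \<le> k then fact k / fact (k - l) * x ^ (k - l) else 0)"

definition prony_moment :: "prony_signal \<Rightarrow> nat \<Rightarrow> complex" where
  "prony_moment F k =
     (\<Sum>j<num_nodes F. \<Sum>l<mult F j. coef F j l * power_deriv l k (node F j))"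

definition prony_solution :: "nat \<Rightarrow> (nat \<Rightarrow> complex) \<Rightarrow> prony_signal \<Rightarrow> bool" where
  "prony_solution d \<mu> F \<longleftrightarrow>
     (\<forall>j<num_nodes F. mult F j > 0) \<and>
     (\<Sum>j<num_nodes F. mult F j) \<le> d \<and>
     inj_on (node F) {..<num_nodes F} \<and>
     (\<forall>j<num_nodes F. coef F j (mult F j - 1) \<noteq> 0) \<and>
     (\<forall>k<2*d. prony_moment F k = \<mu> k)"

definition prony_unsolvable :: "nat \<Rightarrow> (nat \<Rightarrow> complex) set" where
  "prony_unsolvable d = {\<mu> \<in> cvec (2*d). \<nexists>F. prony_solution d \<mu> F}"

text \<open>
  The added \<open>0\<close> only matters for the signal without nodes, where it makes the maximum \<open>0\<close>.
\<close>

definition max_node :: "prony_signal \<Rightarrow> real" where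
  "max_node F = Max (insert 0 ((\<lambda>j. cmod (node F j)) ` {..<num_nodes F}))"

end

theory Submission
  imports Defs "HOL-Library.Multiset"
begin

text \<open>
  Suppose that the nodes stay bounded along some sequence of solvable right-hand sides
  \<open>\<mu>\<^sub>n\<close> that tends to \<open>\<mu>0\<close>. Let \<open>E\<close> be the shift of sequences, \<open>(E m) k = m (k + 1)\<close>. The moments of
  a signal with nodes \<open>x\<^sub>j\<close> of multiplicities \<open>d\<^sub>j\<close> are annihilated by the product of the
  \<open>(E - x\<^sub>j)\<close> to the power \<open>d\<^sub>j\<close>. If the total multiplicity is less than \<open>d\<close>, further factors \<open>E - 0\<close>
  are appended, so that there are always exactly \<open>d\<close> factors
  (\<open>prony_solution_annihilated\<close>). This says that the \<open>2d\<close> numbers \<open>\<mu>\<^sub>n k\<close> satisfy \<open>d\<close> linear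
  equations whose coefficients depend continuously on the roots of the product.

  The roots are bounded, so a subsequence of the root vectors converges in \<open>\<complex>\<^sup>d\<close>, and the \<open>d\<close> equations
  hold in the limit for \<open>\<mu>0\<close>. The product stays monic of degree \<open>d\<close>: this is where
  boundedness of the nodes is used. Conversely, a finite sequence that a product of \<open>d\<close>
  factors \<open>E - y\<close> annihilates is a combination of the sequences \<open>k!/(k-l)! y\<^sup>k\<^sup>-\<^sup>l\<close> with \<open>l\<close> below the
  multiplicity of \<open>y\<close> (\<open>annihilated_imp_in_span\<close>). Removing the zero coefficients turns such a
  combination into a solution of the Prony problem for \<open>\<mu>0\<close>
  (\<open>in_span_imp_prony_solution\<close>). So \<open>\<mu>0\<close> is solvable, a contradiction.
\<close>

section \<open>Products of shifted difference operators\<close>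

definition shift_minus :: "complex \<Rightarrow> (nat \<Rightarrow> complex) \<Rightarrow> nat \<Rightarrow> complex" where
  "shift_minus y m = (\<lambda>k. m (Suc k) - y * m k)"

fun shift_prod :: "complex list \<Rightarrow> (nat \<Rightarrow> complex) \<Rightarrow> nat \<Rightarrow> complex" where
  "shift_prod [] m = m"
| "shift_prod (y # ys) m = shift_prod ys (shift_minus y m)"

lemma shift_minus_linear:
  "shift_minus y (\<lambda>k. m k + c * n k) = (\<lambda>k. shift_minus y m k + c * shift_minus y n k)"
  by (auto simp: shift_minus_def algebra_simps)

lemma shift_prod_linear:
  "shift_prod ys (\<lambda>k. m k + c * n k) = (\<lambda>k. shift_prod ys m k + c * shift_prod ys n k)"
  by (induction ys arbitrary: m n) (simp_all add: shift_minus_linear)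

lemma shift_prod_zero [simp]: "shift_prod ys (\<lambda>k. 0) = (\<lambda>k. 0)"
  by (induction ys) (simp_all add: shift_minus_def)

lemma shift_prod_sum:
  "shift_prod ys (\<lambda>k. \<Sum>i\<in>I. c i * f i k) = (\<lambda>k. \<Sum>i\<in>I. c i * shift_prod ys (f i) k)"
proof (induction I rule: infinite_finite_induct)
  case (insert i I)
  have "(\<lambda>k. \<Sum>i\<in>insert i I. c i * f i k) = (\<lambda>k. (\<Sum>i\<in>I. c i * f i k) + c i * f i k)"
    using insert by (simp add: add.commute)
  then show ?case
    using insert by (simp only: shift_prod_linear) (simp add: add.commute)
qed simp_all

text \<open>
  Entry \<open>k\<close> of the result depends on the entries \<open>k, \<dots>, k + length ys\<close> only. Hence statements about the
  finitely many given moments need no continuation of the moment sequence.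
\<close>

lemma shift_prod_cong:
  assumes "\<And>k. k < N \<Longrightarrow> m k = n k" "k + length ys < N"
  shows "shift_prod ys m k = shift_prod ys n k"
  using assms
proof (induction ys arbitrary: m n k N)
  case (Cons y ys)
  show ?case
    unfolding shift_prod.simps
    by (rule Cons.IH[where N = "N - 1"]) (use Cons.prems in \<open>auto simp: shift_minus_def\<close>)
qed simp

lemma tendsto_shift_prod:
  assumes "\<And>n. length (Y n) = d" "length ys = d"
    and "\<And>i. i < d \<Longrightarrow> ((\<lambda>n. Y n ! i) \<longlongrightarrow> ys ! i) A"
    and "\<And>k. k < N \<Longrightarrow> ((\<lambda>n. M n k) \<longlongrightarrow> m k) A"
    and "k + d < N"
  shows "((\<lambda>n. shift_prod (Y n) (M n) k) \<longlongrightarrow> shift_prod ys m k) A"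
  using assms
proof (induction d arbitrary: Y ys M m N k)
  case 0
  then show ?case by simp
next
  case (Suc d)
  obtain z zs where ys: "ys = z # zs" using Suc.prems(2) by (cases ys) auto
  have Y: "Y n = hd (Y n) # tl (Y n)" for n
    using Suc.prems(1)[of n] by (cases "Y n") auto
  have hd: "((\<lambda>n. hd (Y n)) \<longlongrightarrow> z) A"
  proof -
    have "hd (Y n) = Y n ! 0" for n using Suc.prems(1)[of n] by (intro hd_conv_nth) auto
    then show ?thesis using Suc.prems(3)[of 0] by (simp add: ys)
  qed
  have tl: "((\<lambda>n. tl (Y n) ! i) \<longlongrightarrow> zs ! i) A" if "i < d" for i
  proof -
    have "tl (Y n) ! i = Y n ! Suc i" for n using Suc.prems(1)[of n] that by (intro nth_tl) auto
    then show ?thesis using Suc.prems(3)[of "Suc i"] that by (simp add: ys)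
  qed
  have "((\<lambda>n. shift_prod (tl (Y n)) (shift_minus (hd (Y n)) (M n)) k)
          \<longlongrightarrow> shift_prod zs (shift_minus z m) k) A"
  proof (rule Suc.IH[where N = "N - 1"])
    fix k assume "k < N - 1"
    then show "((\<lambda>n. shift_minus (hd (Y n)) (M n) k) \<longlongrightarrow> shift_minus z m k) A"
      unfolding shift_minus_def by (intro tendsto_intros hd Suc.prems(4)) auto
  qed (use Suc.prems ys tl in auto)
  then show ?case
    by (subst Y) (simp add: ys)
qed

section \<open>Moments are annihilated\<close>

lemma power_deriv_0 [simp]: "power_deriv 0 k x = x ^ k"
  by (simp add: power_deriv_def)

lemma power_deriv_Suc:
  "power_deriv l (Suc k) x = x * power_deriv l k x + of_nat l * power_deriv (l - 1) k x"
proof -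
  consider "l = 0" | "l > Suc k" | "l = Suc k" | i n where "l = Suc i" "k = l + n"
    by (metis Suc_lessI le_add_diff_inverse not_less not0_implies_Suc less_Suc_eq_le)
  then show ?thesis
  proof cases
    case 4
    have "fact (Suc k) / fact (Suc n) = (fact k / fact n + of_nat l * (fact k / fact (Suc n)) :: complex)"
      using 4 by (simp add: divide_simps del: of_nat_Suc) (simp add: algebra_simps)
    then have "fact (Suc k) / fact (Suc n) * x ^ Suc n
        = (fact k / fact n + of_nat l * (fact k / fact (Suc n))) * x ^ Suc n"
      by simp
    moreover have "Suc k - l = Suc n" "k - l = n" "k - (l - 1) = Suc n" "l \<le> Suc k" "l \<le> k" "l - 1 \<le> k"
      using 4 by auto
    ultimately show ?thesis
      by (simp add: power_deriv_def algebra_simps del: fact_Suc)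
  qed (auto simp: power_deriv_def simp del: fact_Suc, simp)
qed

lemma shift_minus_power_deriv:
  "shift_minus y (\<lambda>k. power_deriv l k x) =
     (\<lambda>k. (x - y) * power_deriv l k x + of_nat l * power_deriv (l - 1) k x)"
  by (simp add: shift_minus_def power_deriv_Suc algebra_simps)

text \<open>
  A factor with root \<open>x\<close> lowers the order \<open>l\<close> by one, and any other factor keeps the order at most
  \<open>l\<close>, so each factor can be discharged in the order in which it occurs.
\<close>

lemma shift_prod_power_deriv:
  assumes "l < count (mset ys) x"
  shows "shift_prod ys (\<lambda>k. power_deriv l k x) = (\<lambda>k. 0)"
  using assms
proof (induction ys arbitrary: l)
  case (Cons y ys)
  have "shift_prod (y # ys) (\<lambda>k. power_deriv l k x) =
      shift_prod ys (\<lambda>k. ((\<lambda>k. 0) k + (x - y) * power_deriv l k x) + of_nat l * power_deriv (l - 1) k x)"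
    by (simp add: shift_minus_power_deriv)
  also have "\<dots> = (\<lambda>k. (x - y) * shift_prod ys (\<lambda>k. power_deriv l k x) k +
      of_nat l * shift_prod ys (\<lambda>k. power_deriv (l - 1) k x) k)"
    by (subst shift_prod_linear, subst shift_prod_linear) simp
  also have "\<dots> = (\<lambda>k. 0)"
  proof -
    have "x = y \<or> shift_prod ys (\<lambda>k. power_deriv l k x) = (\<lambda>k. 0)"
      using Cons by auto
    moreover have "l = 0 \<or> shift_prod ys (\<lambda>k. power_deriv (l - 1) k x) = (\<lambda>k. 0)"
      using Cons by (cases l) (auto split: if_splits)
    ultimately show ?thesis by auto
  qed
  finally show ?case .
qed simp

lemma prony_solution_annihilated:
  assumes "prony_solution d \<mu> F"
  shows "\<exists>ys. length ys = d \<and> (\<forall>y\<in>set ys. cmod y \<le> max_node F) \<and>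
    (\<forall>k<d. shift_prod ys \<mu> k = 0)"
proof -
  define r where "r = (\<Sum>j<num_nodes F. mult F j)"
  define M where "M = (\<Sum>j<num_nodes F. replicate_mset (mult F j) (node F j))"
  have le: "r \<le> d" and mom: "\<And>k. k < 2 * d \<Longrightarrow> \<mu> k = prony_moment F k"
    using assms by (auto simp: prony_solution_def r_def)
  obtain zs where zs: "mset zs = M" by (metis ex_mset)
  \<comment> \<open>Padding with the root \<open>0\<close> does no harm to the bound, as \<open>0 \<le> max_node F\<close>.\<close>
  define ys where "ys = zs @ replicate (d - r) 0"
  have "size M = r" by (simp add: M_def r_def size_multiset_sum)
  then have len: "length ys = d"
    using zs le by (simp add: ys_def flip: size_mset)
  have "set zs = set_mset M" by (simp flip: zs)
  also have "\<dots> = (\<Union>j<num_nodes F. set_mset (replicate_mset (mult F j) (node F j)))"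
    by (simp add: M_def set_mset_sum)
  finally have "set ys \<subseteq> insert 0 (node F ` {..<num_nodes F})"
    by (auto simp: ys_def split: if_splits)
  then have bound: "cmod y \<le> max_node F" if "y \<in> set ys" for y
    using that unfolding max_node_def by (intro Max_ge) auto
  have cnt: "mult F j \<le> count (mset ys) (node F j)" if "j < num_nodes F" for j
  proof -
    have "mult F j \<le> (\<Sum>i<num_nodes F. count (replicate_mset (mult F i) (node F i)) (node F j))"
      using member_le_sum[of j "{..<num_nodes F}" "\<lambda>i. count (replicate_mset (mult F i) (node F i)) (node F j)"]
        that by simp
    also have "\<dots> = count M (node F j)" by (simp add: M_def count_sum)
    also have "\<dots> \<le> count (mset ys) (node F j)" by (simp add: ys_def zs)
    finally show ?thesis .
  qed
  have "shift_prod ys (prony_moment F) =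
      shift_prod ys (\<lambda>k. \<Sum>p\<in>(SIGMA j:{..<num_nodes F}. {..<mult F j}).
        coef F (fst p) (snd p) * power_deriv (snd p) k (node F (fst p)))"
    by (simp add: prony_moment_def[abs_def] sum.Sigma case_prod_beta)
  also have "\<dots> = (\<lambda>k. \<Sum>p\<in>(SIGMA j:{..<num_nodes F}. {..<mult F j}).
        coef F (fst p) (snd p) * shift_prod ys (\<lambda>k. power_deriv (snd p) k (node F (fst p))) k)"
    by (rule shift_prod_sum)
  also have "\<dots> = (\<lambda>k. 0)"
  proof (intro ext sum.neutral ballI)
    fix k p assume "p \<in> (SIGMA j:{..<num_nodes F}. {..<mult F j})"
    then have "snd p < count (mset ys) (node F (fst p))"
      using cnt[of "fst p"] by auto
    then show "coef F (fst p) (snd p)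
        * shift_prod ys (\<lambda>k. power_deriv (snd p) k (node F (fst p))) k = 0"
      by (simp add: shift_prod_power_deriv)
  qed
  finally have "shift_prod ys (prony_moment F) = (\<lambda>k. 0)" .
  then have "shift_prod ys \<mu> k = 0" if "k < d" for k
    using shift_prod_cong[of "2 * d" \<mu> "prony_moment F" k ys] mom len that by simp
  with len bound show ?thesis by blast
qed

section \<open>Annihilated sequences are moments\<close>

text \<open>
  The linear span of the sequences \<open>k!/(k-l)! x\<^sup>k\<^sup>-\<^sup>l\<close> with \<open>l\<close> below the multiplicity of \<open>x\<close> in \<open>M\<close>,
  built one term at a time, so that properties of combinations follow by rule induction.
\<close>

inductive_set power_deriv_span :: "complex multiset \<Rightarrow> (nat \<Rightarrow> complex) set" for M where
  zero: "(\<lambda>k. 0) \<in> power_deriv_span M"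
| step: "v \<in> power_deriv_span M \<Longrightarrow> l < count M x \<Longrightarrow>
           (\<lambda>k. v k + c * power_deriv l k x) \<in> power_deriv_span M"

lemma power_deriv_span_linear:
  assumes "w \<in> power_deriv_span M" "v \<in> power_deriv_span M"
  shows "(\<lambda>k. v k + c * w k) \<in> power_deriv_span M"
  using assms(1)
proof induction
  case zero
  then show ?case using assms(2) by simp
next
  case (step w l x b)
  then show ?case
    using power_deriv_span.step[OF step.IH step.hyps(2), of "c * b"] by (simp add: algebra_simps)
qed

lemma power_deriv_in_span:
  "l < count M x \<Longrightarrow> (\<lambda>k. power_deriv l k x) \<in> power_deriv_span M"
  using power_deriv_span.step[OF power_deriv_span.zero, of l M x 1] by simp

text \<open>
  The case \<open>x = y\<close> is the resonant one: there the order has to be raised by one, which the additional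
  copy of \<open>y\<close> in the multiset permits. For \<open>x \<noteq> y\<close> the operator acts on the sequences
  with node \<open>x\<close> by a triangular matrix with diagonal entries \<open>x - y\<close>, inverted by recursion on \<open>l\<close>.
\<close>

lemma shift_minus_preimage_power_deriv:
  assumes "l < count M x"
  shows "\<exists>w\<in>power_deriv_span (add_mset y M). shift_minus y w = (\<lambda>k. power_deriv l k x)"
proof (cases "x = y")
  case True
  define w where "w = (\<lambda>k. 0 + 1 / of_nat (Suc l) * power_deriv (Suc l) k x)"
  have "w \<in> power_deriv_span (add_mset y M)"
    unfolding w_def using assms True by (intro power_deriv_span.intros) auto
  moreover have "shift_minus y w = (\<lambda>k. power_deriv l k x)"
    unfolding w_def shift_minus_linear shift_minus_power_deriv using True
    by (simp add: shift_minus_def del: of_nat_Suc)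
  ultimately show ?thesis by blast
next
  case False
  from assms show ?thesis
  proof (induction l)
    case 0
    define w where "w = (\<lambda>k. 0 + 1 / (x - y) * power_deriv 0 k x)"
    have "w \<in> power_deriv_span (add_mset y M)"
      unfolding w_def using 0 by (intro power_deriv_span.intros) auto
    moreover have "shift_minus y w = (\<lambda>k. power_deriv 0 k x)"
      unfolding w_def shift_minus_linear shift_minus_power_deriv using False
      by (simp add: shift_minus_def)
    ultimately show ?case by blast
  next
    case (Suc l)
    then obtain u where u: "u \<in> power_deriv_span (add_mset y M)"
      "shift_minus y u = (\<lambda>k. power_deriv l k x)" by auto
    define w where "w = (\<lambda>k. (0 + 1 / (x - y) * power_deriv (Suc l) k x)
      + (- of_nat (Suc l) / (x - y)) * u k)"
    have "w \<in> power_deriv_span (add_mset y M)"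
      unfolding w_def using Suc.prems u(1)
      by (intro power_deriv_span_linear power_deriv_span.intros) auto
    moreover have "shift_minus y w = (\<lambda>k. power_deriv (Suc l) k x)"
    proof -
      have "1 / t * (t * p + s * q) + (- s / t) * q = p" if "t \<noteq> 0" for t p s q :: complex
        using that by (simp add: field_simps)
      from this[of "x - y"] show ?thesis
        unfolding w_def shift_minus_linear shift_minus_power_deriv u(2) using False
        by (simp add: shift_minus_def del: of_nat_Suc)
    qed
    ultimately show ?case by blast
  qed
qed

lemma shift_minus_preimage:
  assumes "v \<in> power_deriv_span M"
  shows "\<exists>w\<in>power_deriv_span (add_mset y M). shift_minus y w = v"
  using assms
proof induction
  case zero
  then show ?case
    by (intro bexI[of _ "\<lambda>k. 0"]) (auto simp: shift_minus_def intro: power_deriv_span.zero)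
next
  case (step v l x c)
  from step.IH obtain w where w: "w \<in> power_deriv_span (add_mset y M)" "shift_minus y w = v"
    by blast
  from shift_minus_preimage_power_deriv[OF step.hyps(2)] obtain u
    where u: "u \<in> power_deriv_span (add_mset y M)" "shift_minus y u = (\<lambda>k. power_deriv l k x)"
    by blast
  show ?case
    using power_deriv_span_linear[OF u(1) w(1), of c] w(2) u(2)
    by (intro bexI[of _ "\<lambda>k. w k + c * u k"]) (simp_all add: shift_minus_linear)
qed

text \<open>
  Peeling off the first factor \<open>E - y\<close> leaves a sequence that is shorter by one entry and is
  annihilated by the remaining factors. A preimage of it under \<open>E - y\<close> exists in the larger span, and
  two preimages differ by a multiple of \<open>y\<^sup>k\<close>, which lies in the larger span as well.
\<close>

lemma annihilated_imp_in_span: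
  assumes "\<And>k. k + length ys < N \<Longrightarrow> shift_prod ys m k = 0"
  shows "\<exists>v\<in>power_deriv_span (mset ys). \<forall>k<N. m k = v k"
  using assms
proof (induction ys arbitrary: m N)
  case Nil
  then show ?case by (auto intro: power_deriv_span.zero)
next
  case (Cons y ys)
  have "\<exists>v\<in>power_deriv_span (mset ys). \<forall>k<N - 1. shift_minus y m k = v k"
    by (rule Cons.IH) (use Cons.prems in auto)
  then obtain v where v: "v \<in> power_deriv_span (mset ys)" "\<And>k. k < N - 1 \<Longrightarrow> shift_minus y m k = v k"
    by blast
  from shift_minus_preimage[OF v(1)] obtain w
    where w: "w \<in> power_deriv_span (mset (y # ys))" "shift_minus y w = v" by auto
  have eq: "m k = w k + (m 0 - w 0) * power_deriv 0 k y" if "k < N" for k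
    using that
  proof (induction k)
    case (Suc k)
    have "m (Suc k) - y * m k = w (Suc k) - y * w k"
      using v(2)[of k] w(2) Suc.prems by (auto simp: shift_minus_def fun_eq_iff)
    then have "m (Suc k) - w (Suc k) = y * (m k - w k)" by (simp add: algebra_simps)
    also have "m k - w k = (m 0 - w 0) * power_deriv 0 k y" using Suc by simp
    finally show ?case by (simp add: algebra_simps)
  qed simp
  have "(\<lambda>k. w k + (m 0 - w 0) * power_deriv 0 k y) \<in> power_deriv_span (mset (y # ys))"
    using w(1) by (intro power_deriv_span.step) auto
  then show ?case
    by (rule bexI[rotated]) (intro allI impI eq)
qed

lemma power_deriv_span_explicit:
  assumes "v \<in> power_deriv_span M"
  shows "\<exists>a. \<forall>k. v k = (\<Sum>x\<in>set_mset M. \<Sum>l<count M x. a x l * power_deriv l k x)"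
  using assms
proof induction
  case zero
  then show ?case by (intro exI[of _ "\<lambda>x l. 0"]) simp
next
  case (step v l x c)
  then obtain a where a: "\<And>k. v k = (\<Sum>x\<in>set_mset M. \<Sum>l<count M x. a x l * power_deriv l k x)"
    by blast
  define b where "b z i = a z i + (if z = x then if i = l then c else 0 else 0)" for z i
  have "x \<in># M" using step.hyps(2) by (simp flip: count_greater_zero_iff)
  have "(\<Sum>i<count M z. b z i * power_deriv i k z) =
      (\<Sum>i<count M z. a z i * power_deriv i k z) + (if z = x then c * power_deriv l k x else 0)" for z k
  proof (cases "z = x")
    case True
    have "(\<Sum>i<count M x. b x i * power_deriv i k x) =
        (\<Sum>i<count M x. a x i * power_deriv i k x + (if i = l then c * power_deriv l k x else 0))"
      by (intro sum.cong) (auto simp: b_def algebra_simps)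
    then show ?thesis using step.hyps(2) True by (simp add: sum.distrib)
  qed (simp add: b_def)
  then have "v k + c * power_deriv l k x =
      (\<Sum>z\<in>set_mset M. \<Sum>i<count M z. b z i * power_deriv i k z)" for k
    using \<open>x \<in># M\<close> by (simp add: a sum.distrib)
  then show ?case by blast
qed

text \<open>
  A solution requires nonzero leading coefficients. So points whose coefficients all vanish are
  dropped, and the multiplicity of every other point is cut down to its last nonzero coefficient.
\<close>

lemma in_span_imp_prony_solution:
  assumes "v \<in> power_deriv_span M" "size M \<le> d" "\<And>k. k < 2 * d \<Longrightarrow> \<mu> k = v k"
  shows "\<exists>F. prony_solution d \<mu> F"
proof -
  obtain a where a: "\<And>k. v k = (\<Sum>x\<in>set_mset M. \<Sum>l<count M x. a x l * power_deriv l k x)"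
    using power_deriv_span_explicit[OF assms(1)] by blast
  define L where "L x = {l. l < count M x \<and> a x l \<noteq> 0}" for x
  define X where "X = {x. L x \<noteq> {}}"
  define D where "D x = Suc (Max (L x))" for x
  have finL: "finite (L x)" for x by (simp add: L_def)
  have XM: "X \<subseteq> set_mset M" by (auto simp: X_def L_def simp flip: count_greater_zero_iff)
  then have finX: "finite X" by (rule finite_subset) simp
  have last: "Max (L x) \<in> L x" if "x \<in> X" for x
    using that finL by (auto simp: X_def intro!: Max_in)
  then have D_le: "D x \<le> count M x" if "x \<in> X" for x
    using that by (force simp: D_def L_def Suc_le_eq)
  have D_ge: "l < D x" if "l \<in> L x" for l x
    using Max_ge[OF finL that] by (simp add: D_def)
  obtain h where h: "bij_betw h {..<card X} X"
    using ex_bij_betw_nat_finite[OF finX] by (auto simp: atLeast0LessThan)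
  have hX: "h j \<in> X" if "j < card X" for j
    using h that by (auto simp: bij_betw_def)
  define F where "F = \<lparr>num_nodes = card X, mult = D \<circ> h, node = h, coef = a \<circ> h\<rparr>"
  have "(\<Sum>j<card X. D (h j)) = (\<Sum>x\<in>X. D x)"
    by (rule sum.reindex_bij_betw[OF h])
  also have "\<dots> \<le> (\<Sum>x\<in>X. count M x)" by (intro sum_mono D_le)
  also have "\<dots> \<le> size M"
    unfolding size_multiset_overloaded_eq by (intro sum_mono2 XM) auto
  finally have total: "(\<Sum>j<card X. D (h j)) \<le> d" using assms(2) by simp
  have moment: "prony_moment F k = v k" for k
  proof -
    have "prony_moment F k = (\<Sum>x\<in>X. \<Sum>l<D x. a x l * power_deriv l k x)"
      unfolding prony_moment_def F_def by (simp add: sum.reindex_bij_betw[OF h,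
        of "\<lambda>x. \<Sum>l<D x. a x l * power_deriv l k x"])
    also have "\<dots> = (\<Sum>x\<in>X. \<Sum>l<count M x. a x l * power_deriv l k x)"
      using D_le D_ge by (intro sum.cong sum.mono_neutral_left refl) (force simp: L_def)+
    also have "\<dots> = v k"
      unfolding a using XM by (intro sum.mono_neutral_left) (auto simp: X_def L_def intro!: sum.neutral)
    finally show ?thesis .
  qed
  have "a (h j) (D (h j) - 1) \<noteq> 0" if "j < card X" for j
    using last[OF hX[OF that]] by (simp add: D_def L_def)
  then have "prony_solution d \<mu> F"
    unfolding prony_solution_def using moment assms(3) total h
    by (auto simp: F_def bij_betw_def D_def)
  then show ?thesis by blast
qed

section \<open>Passage to the limit\<close>

lemma bounded_lists_convergent_subseq:
  fixes Y :: "nat \<Rightarrow> complex list"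
  assumes "\<And>n. length (Y n) = d" "\<And>n. \<forall>y\<in>set (Y n). cmod y \<le> R"
  shows "\<exists>r ys. strict_mono (r :: nat \<Rightarrow> nat) \<and> length ys = d \<and>
    (\<forall>i<d. (\<lambda>n. Y (r n) ! i) \<longlonglongrightarrow> ys ! i)"
proof -
  have "\<forall>D\<subseteq>{..<d}. \<exists>l r. strict_mono (r :: nat \<Rightarrow> nat) \<and>
      (\<forall>e>0. eventually (\<lambda>n. \<forall>i\<in>D. dist (((!) \<circ> Y) (r n) i) (l i) < e) sequentially)"
  \<comment> \<open>The lists are viewed as points of \<open>\<complex>\<^sup>d\<close>, with list access as the coordinate functions.\<close>
  proof (rule compact_lemma_general[where unproj = "\<lambda>f. f"])
    fix i assume "i \<in> {..<d}"
    then show "bounded ((\<lambda>f. f i) ` range ((!) \<circ> Y))"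
      unfolding bounded_iff using assms by (intro exI[of _ R]) (auto intro!: bspec[OF assms(2)] nth_mem)
  qed auto
  from this[rule_format, OF subset_refl] obtain l r where r: "strict_mono (r :: nat \<Rightarrow> nat)"
    "\<forall>e>0. eventually (\<lambda>n. \<forall>i\<in>{..<d}. dist (((!) \<circ> Y) (r n) i) (l i) < e) sequentially"
    by (elim exE conjE)
  have "(\<lambda>n. Y (r n) ! i) \<longlonglongrightarrow> map l [0..<d] ! i" if "i < d" for i
    unfolding tendsto_iff
  proof (intro allI impI)
    fix e :: real assume "e > 0"
    then show "eventually (\<lambda>n. dist (Y (r n) ! i) (map l [0..<d] ! i) < e) sequentially"
      by (intro eventually_mono[OF r(2)[rule_format]]) (use that in auto)
  qed
  then show ?thesis using r(1) by (intro exI[of _ r] exI[of _ "map l [0..<d]"]) simp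
qed

theorem theorem3p11:
  fixes d :: nat
    and \<mu>0 :: "nat \<Rightarrow> complex"
    and sol :: "(nat \<Rightarrow> complex) \<Rightarrow> prony_signal"
  assumes "d \<ge> 1"
    and "\<And>\<mu>. \<mu> \<in> cvec (2*d) - prony_unsolvable d \<Longrightarrow> prony_solution d \<mu> (sol \<mu>)"
    and "\<mu>0 \<in> prony_unsolvable d"
  shows "filterlim (\<lambda>\<mu>. max_node (sol \<mu>)) at_top
           (at \<mu>0 within (cvec (2*d) - prony_unsolvable d))"
proof (rule ccontr)
  let ?S = "cvec (2*d) - prony_unsolvable d"
  let ?dist = "\<lambda>\<mu>. L2_set (\<lambda>k. cmod (\<mu> k - \<mu>0 k)) {..<2*d}"
  have \<mu>0: "\<mu>0 \<in> cvec (2*d)" using assms(3) by (simp add: prony_unsolvable_def)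
  assume "\<not> ?thesis"
  then obtain R where "\<not> eventually (\<lambda>\<mu>. R \<le> max_node (sol \<mu>)) (at \<mu>0 within ?S)"
    by (auto simp: filterlim_at_top)
  then have "\<forall>e>0. \<exists>\<mu>\<in>?S. ?dist \<mu> < e \<and> max_node (sol \<mu>) < R"
    by (subst (asm) eventually_at_cvec[OF _ \<mu>0]) (auto simp: not_le)
  then have "\<exists>\<mu>\<in>?S. ?dist \<mu> < inverse (real (Suc n)) \<and> max_node (sol \<mu>) < R" for n
    by simp
  then obtain \<mu> where \<mu>: "\<And>n. \<mu> n \<in> ?S" "\<And>n. ?dist (\<mu> n) < inverse (real (Suc n))"
      "\<And>n. max_node (sol (\<mu> n)) < R"
    by metis
  have lim: "(\<lambda>n. \<mu> n k) \<longlonglongrightarrow> \<mu>0 k" if "k < 2 * d" for k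
  proof (rule LIM_zero_cancel, rule Lim_null_comparison[OF always_eventually LIMSEQ_inverse_real_of_nat], rule allI)
    fix n
    have "cmod (\<mu> n k - \<mu>0 k) \<le> ?dist (\<mu> n)"
      using that by (intro member_le_L2_set) auto
    also have "\<dots> \<le> inverse (real (Suc n))" by (rule less_imp_le) (rule \<mu>(2))
    finally show "norm (\<mu> n k - \<mu>0 k) \<le> inverse (real (Suc n))" .
  qed
  have "\<forall>n. \<exists>ys. length ys = d \<and> (\<forall>y\<in>set ys. cmod y \<le> max_node (sol (\<mu> n))) \<and>
      (\<forall>k<d. shift_prod ys (\<mu> n) k = 0)"
    by (intro allI prony_solution_annihilated assms(2) \<mu>(1))
  from choice[OF this] obtain Y where Y: "\<And>n. length (Y n) = d"
      "\<And>n y. y \<in> set (Y n) \<Longrightarrow> cmod y \<le> max_node (sol (\<mu> n))"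
      "\<And>n k. k < d \<Longrightarrow> shift_prod (Y n) (\<mu> n) k = 0"
    by auto
  have Y_le: "\<forall>y\<in>set (Y n). cmod y \<le> R" for n
    using Y(2)[of _ n] \<mu>(3)[of n] by (auto intro: order_trans less_imp_le)
  obtain r ys where r: "strict_mono (r :: nat \<Rightarrow> nat)" and ys: "length ys = d"
      "\<forall>i<d. (\<lambda>n. Y (r n) ! i) \<longlonglongrightarrow> ys ! i"
    using bounded_lists_convergent_subseq[of Y d R, OF Y(1) Y_le] by (elim exE conjE)
  have "shift_prod ys \<mu>0 k = 0" if "k < d" for k
  proof -
    have "(\<lambda>n. shift_prod (Y (r n)) (\<mu> (r n)) k) \<longlonglongrightarrow> shift_prod ys \<mu>0 k"
    proof (rule tendsto_shift_prod[where d = d and N = "2 * d"])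
      show "(\<lambda>n. \<mu> (r n) j) \<longlonglongrightarrow> \<mu>0 j" if "j < 2 * d" for j
        using LIMSEQ_subseq_LIMSEQ[OF lim[OF that] r] by (simp add: o_def)
    qed (use Y(1) ys that in auto)
    then show ?thesis using Y(3)[OF that] by (simp add: LIMSEQ_const_iff)
  qed
  then have "\<exists>v\<in>power_deriv_span (mset ys). \<forall>k<2 * d. \<mu>0 k = v k"
    by (intro annihilated_imp_in_span) (simp add: ys(1))
  then obtain v where v: "v \<in> power_deriv_span (mset ys)" "\<And>k. k < 2 * d \<Longrightarrow> \<mu>0 k = v k"
    by blast
  have "\<exists>F. prony_solution d \<mu>0 F"
    by (rule in_span_imp_prony_solution[OF v(1) _ v(2)]) (simp_all add: ys(1))
  then show False using assms(3) by (simp add: prony_unsolvable_def)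
qed

end
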